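(* Let $R$ be an integrally closed integral domain. Then the following statements are equivalent. (1) $R$ is an sQQR-domain. (2) $R$ is an fQQR-domain. (3) $R$ is a QQR-domain. (4) $R$ is a Prüfer domain.
   Context: Let $R$ be an integral domain with quotient field $K$. An overring of $R$ is a ring $T$ with $R \subseteq T \subseteq K$. A simple overring is one of the form $R[u]$ with $u \in K$; a finitely generated overring is one of the form $R[U]$ with $U$ a finite subset of $K$. An overring is an intersection of localizations of $R$ if it equals $\bigcap_{P \in \mathcal P} R_P$ for some set $\mathcal P$ of prime ideals of $R$. $R$ is an sQQR-domain (respectively fQQR-domain, QQR-domain) if each simple overring (respectively each finitely generated overring, each overring) of $R$ is an intersection of localizations of $R$. *)

theory Defs
  imports "HOL-Computational_Algebra.Computational_Algebra"
begin

text \<open>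
  The integral domain \<open>R\<close> is a type \<open>'a\<close> of class \<open>idom\<close>, its quotient field \<open>K\<close> is
  the type \<open>'a fract\<close>, and \<open>R\<close> is regarded as the subring \<open>range to_fract\<close> of \<open>K\<close>.
  Properties of \<open>R\<close> itself take the argument \<open>TYPE('a)\<close>.
\<close>

text \<open>
  Both \<open>R\<close> and \<open>K\<close> as \<open>R\<close>-modules: the subspaces of \<open>ideal\<close> are the ideals of \<open>R\<close>, and
  those of \<open>submodule\<close> the \<open>R\<close>-submodules of \<open>K\<close>.
\<close>

interpretation ideal: module "(*) :: 'a::idom \<Rightarrow> 'a \<Rightarrow> 'a"
  by unfold_locales (simp_all add: algebra_simps)

lemmas [simp del] = ideal.scale_scale

interpretation submodule: module "\<lambda>(r::'a::idom) (x::'a fract). to_fract r * x"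
  by unfold_locales (simp_all add: algebra_simps)

lemmas [simp del] = submodule.scale_scale

definition prime_ideal :: "'a::idom set \<Rightarrow> bool" where
  "prime_ideal P \<longleftrightarrow>
     ideal.subspace P \<and> P \<noteq> UNIV \<and> (\<forall>a b. a * b \<in> P \<longrightarrow> a \<in> P \<or> b \<in> P)"

definition localization :: "'a::idom set \<Rightarrow> 'a fract set" where
  "localization P = {to_fract a / to_fract s | a s. s \<notin> P}"

definition overring :: "'a::idom fract set \<Rightarrow> bool" where
  "overring T \<longleftrightarrow> range to_fract \<subseteq> T \<and>
     (\<forall>x\<in>T. \<forall>y\<in>T. x + y \<in> T) \<and> (\<forall>x\<in>T. - x \<in> T) \<and> (\<forall>x\<in>T. \<forall>y\<in>T. x * y \<in> T)"

text \<open>\<open>R[U]\<close>, the smallest subring of \<open>K\<close> containing \<open>R\<close> and \<open>U\<close>.\<close>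

definition adjoin :: "'a::idom fract set \<Rightarrow> 'a fract set" where
  "adjoin U = overring hull U"

definition simple_overring :: "'a::idom fract set \<Rightarrow> bool" where
  "simple_overring T \<longleftrightarrow> (\<exists>u. T = adjoin {u})"

definition finitely_generated_overring :: "'a::idom fract set \<Rightarrow> bool" where
  "finitely_generated_overring T \<longleftrightarrow> (\<exists>U. finite U \<and> T = adjoin U)"

text \<open>
  The empty family is allowed; its intersection is \<open>K\<close>, which is also the localization at
  the zero ideal.
\<close>

definition intersection_of_localizations :: "'a::idom fract set \<Rightarrow> bool" where
  "intersection_of_localizations T \<longleftrightarrow>
     (\<exists>\<P>. (\<forall>P\<in>\<P>. prime_ideal P) \<and> T = (\<Inter>P\<in>\<P>. localization P))"

definition sQQR_domain :: "'a::idom itself \<Rightarrow> bool" where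
  "sQQR_domain _ \<longleftrightarrow>
     (\<forall>T::'a fract set. simple_overring T \<longrightarrow> intersection_of_localizations T)"

definition fQQR_domain :: "'a::idom itself \<Rightarrow> bool" where
  "fQQR_domain _ \<longleftrightarrow>
     (\<forall>T::'a fract set. finitely_generated_overring T \<longrightarrow> intersection_of_localizations T)"

definition QQR_domain :: "'a::idom itself \<Rightarrow> bool" where
  "QQR_domain _ \<longleftrightarrow>
     (\<forall>T::'a fract set. overring T \<longrightarrow> intersection_of_localizations T)"

definition integrally_closed :: "'a::idom itself \<Rightarrow> bool" where
  "integrally_closed _ \<longleftrightarrow>
     (\<forall>x::'a fract. (\<exists>p::'a poly. lead_coeff p = 1 \<and> poly (fract_poly p) x = 0) \<longrightarrow>
        x \<in> range to_fract)"

definition fractional_ideal :: "'a::idom fract set \<Rightarrow> bool" where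
  "fractional_ideal J \<longleftrightarrow> submodule.subspace J \<and>
     (\<exists>d. d \<noteq> 0 \<and> (\<forall>x\<in>J. to_fract d * x \<in> range to_fract))"

definition invertible_ideal :: "'a::idom set \<Rightarrow> bool" where
  "invertible_ideal I \<longleftrightarrow>
     (\<exists>J. fractional_ideal J \<and>
        submodule.span {to_fract a * x | a x. a \<in> I \<and> x \<in> J} = range to_fract)"

definition prufer_domain :: "'a::idom itself \<Rightarrow> bool" where
  "prufer_domain _ \<longleftrightarrow>
     (\<forall>A::'a set. finite A \<and> ideal.span A \<noteq> {0} \<longrightarrow> invertible_ideal (ideal.span A))"

end

theory Submission
  imports Defs
begin

text \<open>
  If every simple overring of an integrally closed domain \<open>R\<close> is an intersection of
  localizations, then each \<open>R[u\<^sup>2]\<close> contains \<open>u\<close>, because localizations of \<open>R\<close> are integrally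
  closed. So \<open>u\<close> is a root of a polynomial over \<open>R\<close> whose linear coefficient is a unit, and
  Seidenberg's lemma puts \<open>u\<close> or \<open>1 / u\<close> into each \<open>R\<^sub>P\<close>. Hence among the generators of a
  finitely generated ideal \<open>I\<close> one divides all others in \<open>R\<^sub>P\<close>, so that \<open>I (R : I)\<close> lies in no
  prime \<open>P\<close>.

  Conversely, let \<open>T\<close> be an overring of a Pruefer domain \<open>R\<close>. If \<open>M\<close> is a prime ideal of \<open>T\<close> and
  \<open>P = M \<inter> R\<close>, invertibility of the ideals \<open>(a, b)\<close> gives \<open>T \<subseteq> R\<^sub>P\<close>. An element \<open>z\<close> of all these
  \<open>R\<^sub>P\<close> lies in \<open>T\<close>, since otherwise \<open>M\<close> could be chosen to contain \<open>{t \<in> T. t z \<in> T}\<close>.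
\<close>

subsection \<open>Overrings and their ideals\<close>

lemma overring_hull: "overring (overring hull U)"
proof (rule hull_in)
  fix \<T> :: "'a fract set set" assume S: "\<forall>S\<in>\<T>. overring S"
  have "range to_fract \<subseteq> \<Inter>\<T>"
    by (rule Inter_greatest) (use S in \<open>simp add: overring_def\<close>)
  then show "overring (\<Inter>\<T>)"
    using S by (simp add: overring_def)
qed

lemma overring_adjoin: "overring (adjoin U)"
  by (simp add: adjoin_def overring_hull)

lemma adjoin_minimal: "\<lbrakk>U \<subseteq> T; overring T\<rbrakk> \<Longrightarrow> adjoin U \<subseteq> T"
  by (simp add: adjoin_def hull_minimal)

lemma subset_adjoin: "U \<subseteq> adjoin U"
  by (simp add: adjoin_def hull_subset)

lemma overring_range_to_fract: "overring (range (to_fract :: 'a::idom \<Rightarrow> 'a fract))"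
  by (auto simp: overring_def simp flip: to_fract_add to_fract_mult to_fract_uminus)

text \<open>\<open>T\<close> is a set and not a type, so \<open>ideal.subspace\<close> cannot
  express its ideals. For an overring \<open>T\<close>, negatives come from the factor
  \<open>- 1\<close> in \<open>T\<close>.\<close>

definition overring_ideal :: "'a::idom fract set \<Rightarrow> 'a fract set \<Rightarrow> bool" where
  "overring_ideal T I \<longleftrightarrow> I \<subseteq> T \<and> 0 \<in> I \<and>
     (\<forall>x\<in>I. \<forall>y\<in>I. x + y \<in> I) \<and> (\<forall>t\<in>T. \<forall>x\<in>I. t * x \<in> I)"

text \<open>The ideal \<open>M + T a\<close>, against which the maximality of an ideal
  \<open>M\<close> is tested.\<close>

lemma overring_ideal_insert:
  assumes T: "overring T" and M: "overring_ideal T M" and a: "a \<in> T"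
  shows "overring_ideal T {m + t * a | m t. m \<in> M \<and> t \<in> T}" (is "overring_ideal T ?N")
proof -
  have NI: "m + t * a \<in> ?N" if "m \<in> M" "t \<in> T" for m t
    using that by blast
  have T_add: "x + y \<in> T" and T_mult: "x * y \<in> T" if "x \<in> T" "y \<in> T" for x y
    using T that by (auto simp: overring_def)
  have M_sub: "M \<subseteq> T" and M_0: "0 \<in> M"
    using M by (auto simp: overring_ideal_def)
  have M_add: "x + y \<in> M" if "x \<in> M" "y \<in> M" for x y
    using M that by (auto simp: overring_ideal_def)
  have M_mult: "t * x \<in> M" if "t \<in> T" "x \<in> M" for t x
    using M that by (auto simp: overring_ideal_def)
  have "?N \<subseteq> T"
    using M_sub a by (auto intro!: T_add T_mult)
  moreover have "0 \<in> ?N"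
    using NI[OF M_0] M_sub M_0 by force
  moreover have "x + y \<in> ?N" if xy: "x \<in> ?N" "y \<in> ?N" for x y
  proof -
    obtain m t where x: "x = m + t * a" "m \<in> M" "t \<in> T"
      using xy(1) by blast
    obtain m' t' where y: "y = m' + t' * a" "m' \<in> M" "t' \<in> T"
      using xy(2) by blast
    have "x + y = (m + m') + (t + t') * a"
      unfolding x(1) y(1) by (simp add: algebra_simps)
    then show ?thesis
      using NI[OF M_add[OF x(2) y(2)] T_add[OF x(3) y(3)]] by (simp only:)
  qed
  moreover have "s * x \<in> ?N" if s: "s \<in> T" and x: "x \<in> ?N" for s x
  proof -
    obtain m t where x: "x = m + t * a" "m \<in> M" "t \<in> T"
      using x by blast
    have "s * x = s * m + (s * t) * a"
      unfolding x(1) by (simp add: algebra_simps)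
    then show ?thesis
      using NI[OF M_mult[OF s x(2)] T_mult[OF s x(3)]] by (simp only:)
  qed
  ultimately show ?thesis
    unfolding overring_ideal_def by (intro conjI ballI)
qed

lemma overring_ideal_Union_chain:
  assumes "\<C> \<noteq> {}" and "subset.chain \<A> \<C>" and "\<And>I. I \<in> \<C> \<Longrightarrow> overring_ideal T I"
  shows "overring_ideal T (\<Union>\<C>)"
proof -
  have "x + y \<in> \<Union>\<C>" if xy: "x \<in> \<Union>\<C>" "y \<in> \<Union>\<C>" for x y
  proof -
    obtain I J where IJ: "I \<in> \<C>" "J \<in> \<C>" "x \<in> I" "y \<in> J"
      using xy by blast
    moreover have "I \<subseteq> J \<or> J \<subseteq> I"
      using assms(2) IJ by (auto simp: subset_chain_def)
    ultimately obtain L where "L \<in> \<C>" "x \<in> L" "y \<in> L"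
      by blast
    then show ?thesis
      using assms(3)[of L] by (auto simp: overring_ideal_def)
  qed
  moreover have "0 \<in> \<Union>\<C>" "\<Union>\<C> \<subseteq> T" "\<forall>t\<in>T. \<forall>x\<in>\<Union>\<C>. t * x \<in> \<Union>\<C>"
    using assms(1,3) unfolding overring_ideal_def by blast+
  ultimately show ?thesis
    by (auto simp only: overring_ideal_def)
qed

text \<open>Zorn's lemma gives \<open>M\<close> maximal among the ideals of \<open>T\<close> that
  contain \<open>I\<close> and omit \<open>1\<close>. Such an \<open>M\<close> is prime in
  \<open>T\<close>, so its contraction to \<open>R\<close> is prime; the contraction is stated
  because localizations are taken at primes of \<open>R\<close>.\<close>

lemma exists_prime_contraction:
  assumes T: "overring T" and I: "overring_ideal T I" and I1: "1 \<notin> I"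
  obtains M where "overring_ideal T M" "I \<subseteq> M" "prime_ideal (to_fract -` M)"
proof -
  let ?A = "{M. overring_ideal T M \<and> I \<subseteq> M \<and> 1 \<notin> M}"
  have "\<exists>M\<in>?A. \<forall>X\<in>?A. M \<subseteq> X \<longrightarrow> X = M"
  proof (rule subset_Zorn_nonempty)
    show "?A \<noteq> {}"
      using I I1 by blast
    fix \<C> assume C: "\<C> \<noteq> {}" "subset.chain ?A \<C>"
    then have sub: "\<C> \<subseteq> ?A"
      by (simp add: subset_chain_def)
    then have "overring_ideal T (\<Union>\<C>)"
      using overring_ideal_Union_chain[OF C] by blast
    moreover have "I \<subseteq> \<Union>\<C>" "1 \<notin> \<Union>\<C>"
      using sub C(1) by auto
    ultimately show "\<Union>\<C> \<in> ?A"
      by simp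
  qed
  then obtain M where MA: "M \<in> ?A" and max: "\<forall>X\<in>?A. M \<subseteq> X \<longrightarrow> X = M"
    by (rule bexE)
  then have M: "overring_ideal T M" "I \<subseteq> M" "1 \<notin> M"
    by simp_all
  have R: "to_fract r \<in> T" for r
    using T by (auto simp: overring_def)
  have add: "\<And>x y. \<lbrakk>x \<in> M; y \<in> M\<rbrakk> \<Longrightarrow> x + y \<in> M"
    and mult: "\<And>t x. \<lbrakk>t \<in> T; x \<in> M\<rbrakk> \<Longrightarrow> t * x \<in> M" and zero: "0 \<in> M"
    using M(1) by (auto simp: overring_ideal_def)
  have prime: "b \<in> M" if a: "a \<in> T" "a \<notin> M" and b: "b \<in> T" "a * b \<in> M" for a b
  proof -
    let ?N = "{m + t * a | m t. m \<in> M \<and> t \<in> T}"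
    have N: "overring_ideal T ?N"
      by (rule overring_ideal_insert[OF T M(1) a(1)])
    have "a = 0 + 1 * a" "1 \<in> T"
      using R[of 1] by simp_all
    then have aN: "a \<in> ?N"
      using zero by blast
    have MN: "M \<subseteq> ?N"
    proof
      fix m assume "m \<in> M"
      moreover have "m = m + 0 * a" "0 \<in> T"
        using R[of 0] by simp_all
      ultimately show "m \<in> ?N" by blast
    qed
    \<comment> \<open>Otherwise maximality gives \<open>M + T a = M\<close>, although
      \<open>a\<close> is outside \<open>M\<close>. Multiplying \<open>1 = m + t a\<close> by
      \<open>b\<close> then puts \<open>b\<close> into \<open>M\<close>.\<close>
    have "1 \<in> ?N"
    proof (rule ccontr)
      assume "1 \<notin> ?N"
      with N M(2) MN have "?N \<in> ?A"
        by simp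
      with max MN have "?N = M"
        by simp
      with aN a(2) show False
        by simp
    qed
    then obtain m t where mt: "1 = m + t * a" "m \<in> M" "t \<in> T"
      by blast
    have "b = (m + t * a) * b"
      using mt(1) by simp
    also have "\<dots> = b * m + t * (a * b)"
      by (simp add: algebra_simps)
    finally show ?thesis
      using add[OF mult[OF b(1) mt(2)] mult[OF mt(3) b(2)]] by simp
  qed
  have "prime_ideal (to_fract -` M)"
    unfolding prime_ideal_def
  proof (intro conjI allI impI)
    show "ideal.subspace (to_fract -` M)"
      using add mult R zero by (auto simp: ideal.subspace_def)
    show "to_fract -` M \<noteq> UNIV"
      using M(3) by (metis UNIV_I to_fract_1 vimageD)
    show "a \<in> to_fract -` M \<or> b \<in> to_fract -` M" if "a * b \<in> to_fract -` M" for a b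
      using that prime R by auto
  qed
  with M that show ?thesis by blast
qed

text \<open>The case \<open>T = R\<close> of the previous lemma, transported along the embedding
  \<open>to_fract\<close>.\<close>

lemma exists_prime_ideal:
  assumes I: "ideal.subspace I" and "1 \<notin> (I :: 'a::idom set)"
  obtains P where "prime_ideal P" "I \<subseteq> P"
proof -
  have "overring_ideal (range to_fract) (to_fract ` I)"
    using I by (auto simp: overring_ideal_def ideal.subspace_def
                     simp flip: to_fract_add to_fract_mult to_fract_0)
  moreover have "1 \<notin> to_fract ` I"
    using assms(2) by (auto simp flip: to_fract_1)
  ultimately obtain M where "to_fract ` I \<subseteq> M" "prime_ideal (to_fract -` M)"
    using exists_prime_contraction[OF overring_range_to_fract] by metis
  with that show ?thesis by blast
qed

subsection \<open>Localizations\<close>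

lemma prime_idealD:
  assumes "prime_ideal P"
  shows "0 \<in> P" "1 \<notin> P" "\<lbrakk>a \<in> P; b \<in> P\<rbrakk> \<Longrightarrow> a + b \<in> P" "b \<in> P \<Longrightarrow> a * b \<in> P"
    "a * b \<in> P \<Longrightarrow> a \<in> P \<or> b \<in> P"
proof -
  have sub: "ideal.subspace P" and "P \<noteq> UNIV"
    using assms by (auto simp: prime_ideal_def)
  then show "1 \<notin> P"
    by (metis UNIV_eq_I ideal.subspace_scale mult.right_neutral)
qed (use assms in \<open>auto simp: prime_ideal_def ideal.subspace_def\<close>)

lemma localization_iff:
  assumes "prime_ideal P"
  shows "x \<in> localization P \<longleftrightarrow> (\<exists>a s. s \<notin> P \<and> to_fract s * x = to_fract a)"
proof -
  have "x = to_fract a / to_fract s \<longleftrightarrow> to_fract s * x = to_fract a" if "s \<notin> P" for a s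
  proof -
    have "to_fract s \<noteq> 0"
      using that prime_idealD(1)[OF assms] by auto
    then show ?thesis
      by (auto simp: field_simps)
  qed
  then show ?thesis
    by (auto simp: localization_def)
qed

lemma localization_closed:
  assumes P: "prime_ideal P"
  shows "to_fract r \<in> localization P"
    "\<lbrakk>x \<in> localization P; y \<in> localization P\<rbrakk> \<Longrightarrow> x * y \<in> localization P"
proof -
  show "to_fract r \<in> localization P"
    unfolding localization_iff[OF P] using prime_idealD(2)[OF P]
    by (intro exI[of _ r] exI[of _ 1]) simp
next
  assume "x \<in> localization P" "y \<in> localization P"
  then obtain a s b t where "s \<notin> P" "t \<notin> P"
    and eq: "to_fract s * x = to_fract a" "to_fract t * y = to_fract b"
    by (auto simp: localization_iff[OF P])
  moreover have "to_fract (s * t) * (x * y) = (to_fract s * x) * (to_fract t * y)"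
    by (simp add: mult_ac)
  then have "to_fract (s * t) * (x * y) = to_fract (a * b)"
    by (simp only: eq to_fract_mult)
  ultimately show "x * y \<in> localization P"
    using prime_idealD(5)[OF P] unfolding localization_iff[OF P] by blast
qed

subsection \<open>Integrally closed domains\<close>

text \<open>\<open>x\<close> is a root of the monic polynomial \<open>X^2 - a\<close>.\<close>

lemma integrally_closed_sqrt:
  assumes "integrally_closed TYPE('a::idom)" and "x\<^sup>2 = to_fract (a::'a)"
  shows "x \<in> range to_fract"
proof -
  have "lead_coeff [:- a, 0, 1:] = 1" "poly (fract_poly [:- a, 0, 1:]) x = 0"
    using assms(2) by (simp_all add: power2_eq_square map_poly_pCons)
  with assms(1) show ?thesis
    unfolding integrally_closed_def by blast
qed

text \<open>If \<open>s x^2 = a\<close>, then \<open>(s x)^2 = s a\<close> lies in \<open>R\<close>.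
  Hence so does \<open>s x\<close>, and \<open>s\<close> is a denominator of \<open>x\<close>
  outside \<open>P\<close>.\<close>

lemma localization_sqrt:
  assumes ic: "integrally_closed TYPE('a::idom)" and P: "prime_ideal (P::'a set)"
    and "x\<^sup>2 \<in> localization P"
  shows "x \<in> localization P"
proof -
  obtain a s where s: "s \<notin> P" and "to_fract s * x\<^sup>2 = to_fract a"
    using assms(3) by (auto simp: localization_iff[OF P])
  then have "(to_fract s * x)\<^sup>2 = to_fract (s * a)"
    by (simp add: power2_eq_square algebra_simps flip: \<open>to_fract s * x\<^sup>2 = to_fract a\<close>)
  then have "to_fract s * x \<in> range to_fract"
    by (rule integrally_closed_sqrt[OF ic])
  with s show ?thesis
    by (auto simp: localization_iff[OF P])
qed

lemma to_fract_power: "to_fract (x ^ n) = to_fract x ^ n"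
  by (induction n) auto

lemma fract_poly_sum: "fract_poly (\<Sum>i\<in>A. f i) = (\<Sum>i\<in>A. fract_poly (f i))"
  by (induction A rule: infinite_finite_induct) auto

lemma poly_fract_poly_altdef:
  "poly (fract_poly p) x = (\<Sum>i\<le>degree p. to_fract (coeff p i) * x ^ i)"
  by (simp add: poly_altdef degree_map_poly coeff_map_poly)

text \<open>Multiplying \<open>p(u) = 0\<close> by \<open>a^n\<close>, with \<open>a\<close> the
  leading coefficient, yields a monic equation for \<open>a u\<close>.\<close>

lemma integrally_closed_lead_coeff_mult:
  assumes ic: "integrally_closed TYPE('a::idom)"
    and deg: "degree (p::'a poly) = Suc n" and root: "poly (fract_poly p) u = 0"
  shows "to_fract (lead_coeff p) * u \<in> range to_fract"
proof -
  define a where "a = lead_coeff p"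
  \<comment> \<open>The weights \<open>a ^ (n - i)\<close> are chosen so that
    \<open>g(a u) = a^n p(u)\<close>.\<close>
  define q where "q = (\<Sum>i\<le>n. monom (coeff p i * a ^ (n - i)) i)"
  define g where "g = monom 1 (Suc n) + q"
  have "degree q \<le> n"
    unfolding q_def by (intro degree_sum_le) (auto intro: order.trans[OF degree_monom_le])
  then have "degree q < degree (monom (1::'a) (Suc n))"
    by (simp add: degree_monom_eq)
  then have monic: "lead_coeff g = 1"
    unfolding g_def by (simp add: lead_coeff_add_le degree_monom_eq degree_add_eq_left coeff_eq_0)
  have q: "poly (fract_poly q) (to_fract a * u) =
      to_fract a ^ n * (\<Sum>i\<le>n. to_fract (coeff p i) * u ^ i)"
    unfolding q_def
    by (auto simp: fract_poly_sum map_poly_monom poly_sum poly_monom sum_distrib_left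
        power_mult_distrib to_fract_power power_add mult_ac intro!: sum.cong dest!: le_Suc_ex)
  have "poly (fract_poly g) (to_fract a * u) = to_fract a ^ n * poly (fract_poly p) u"
    by (simp add: g_def q map_poly_monom poly_monom poly_fract_poly_altdef[of p] deg
        power_mult_distrib)
      (simp add: a_def deg algebra_simps)
  then have "poly (fract_poly g) (to_fract a * u) = 0"
    by (simp add: root)
  with monic ic show ?thesis
    unfolding integrally_closed_def a_def by blast
qed

text \<open>
  Seidenberg's lemma. When neither the leading coefficient \<open>a\<close> nor \<open>b = a u \<in> R\<close> avoids \<open>P\<close>, the
  term \<open>a u\<^sup>n\<^sup>+\<^sup>1\<close> is absorbed as \<open>b u\<^sup>n\<close>, which does not change coefficients modulo \<open>P\<close>.
\<close>

lemma localization_or_inverse: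
  assumes ic: "integrally_closed TYPE('a::idom)" and P: "prime_ideal (P::'a set)"
    and "poly (fract_poly p) u = 0" and "coeff p i \<notin> P"
  shows "u \<in> localization P \<or> inverse u \<in> localization P"
proof -
  \<comment> \<open>The induction runs over a bound on the degree, since absorbing the leading term
    may lower the degree by more than one.\<close>
  have "degree p \<le> n \<Longrightarrow> ?thesis" for n
    using assms(3,4)
  proof (induction n arbitrary: p)
    \<comment> \<open>A constant polynomial with a root is zero, so no coefficient avoids
      \<open>P\<close> and the case is vacuous.\<close>
    case 0
    then obtain c where "p = [:c:]"
      by (metis degree_eq_zeroE le_zero_eq)
    with 0 prime_idealD(1)[OF P] show ?case
      by (cases i) (auto simp: map_poly_pCons)
  next
    case (Suc n)
    define a where "a = coeff p (Suc n)"
    show ?case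
    proof (cases "degree p \<le> n")
      case True
      with Suc show ?thesis by blast
    next
      case False
      with Suc.prems have deg: "degree p = Suc n"
        by simp
      obtain b where b: "to_fract a * u = to_fract b"
        using integrally_closed_lead_coeff_mult[OF ic deg Suc.prems(2)]
        unfolding a_def deg by blast
      consider "a \<notin> P" | "b \<notin> P" | "a \<in> P" "b \<in> P" by blast
      then show ?thesis
      proof cases
        case 1
        with b show ?thesis
          by (auto simp: localization_iff[OF P])
      next
        case 2
        then have "b \<noteq> 0"
          using prime_idealD(1)[OF P] by blast
        with b have "u \<noteq> 0"
          by auto
        with b have "to_fract b * inverse u = to_fract a"
          by (simp add: field_simps flip: b)
        with 2 show ?thesis
          by (auto simp: localization_iff[OF P])
      next
        case 3
        define q where "q = p - monom a (Suc n) + monom b n"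
        have "degree q \<le> n"
        proof (rule degree_le, intro allI impI)
          fix j assume "n < j"
          then show "coeff q j = 0"
            using deg by (cases "j = Suc n") (auto simp: q_def a_def coeff_eq_0)
        qed
        moreover have "poly (fract_poly q) u = 0"
        proof -
          have "poly (fract_poly q) u =
              poly (fract_poly p) u - to_fract a * u ^ Suc n + to_fract b * u ^ n"
            by (simp add: q_def map_poly_monom poly_monom)
          also have "\<dots> = 0"
            using Suc.prems(2) by (simp flip: b)
          finally show ?thesis .
        qed
        moreover have "coeff q i \<notin> P"
        proof
          assume "coeff q i \<in> P"
          moreover have "coeff p i = coeff q i +
              ((if i = Suc n then 1 else 0) * a + (if i = n then - 1 else 0) * b)"
            by (simp add: q_def)
          ultimately have "coeff p i \<in> P"
            using 3 prime_idealD(3,4)[OF P] by metis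
          with Suc.prems(3) show False ..
        qed
        ultimately show ?thesis
          by (rule Suc.IH)
      qed
    qed
  qed
  then show ?thesis by blast
qed

section \<open>Simple overrings and the sQQR condition\<close>

lemma poly_fract_poly_pcompose:
  "poly (fract_poly (pcompose p q)) x = poly (fract_poly p) (poly (fract_poly q) x)"
  by (induction p) (simp_all add: pcompose_pCons map_poly_pCons)

text \<open>The values at \<open>v\<close> of polynomials over \<open>R\<close> form an overring
  containing \<open>v\<close>, so they include \<open>R[v]\<close> by minimality.\<close>

lemma adjoin_singletonE:
  assumes "x \<in> adjoin {v}"
  obtains p where "x = poly (fract_poly p) v"
proof -
  let ?T = "range (\<lambda>p. poly (fract_poly p) v)"
  have C: "to_fract r \<in> ?T" for r
    by (rule range_eqI[of _ _ "[:r:]"]) (simp add: map_poly_pCons)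
  have add: "x + y \<in> ?T" and mult: "x * y \<in> ?T" if "x \<in> ?T" "y \<in> ?T" for x y
    using that by (auto simp flip: poly_add poly_mult fract_poly_add fract_poly_mult)
  have "- x \<in> ?T" if "x \<in> ?T" for x
    using mult[OF C[of "- 1"] that] by simp
  with C add mult have "overring ?T"
    unfolding overring_def by blast
  moreover have "v \<in> ?T"
    by (rule range_eqI[of _ _ "[:0, 1:]"]) (simp add: map_poly_pCons)
  ultimately have "adjoin {v} \<subseteq> ?T"
    by (intro adjoin_minimal) auto
  with assms that show ?thesis
    by blast
qed

lemma sQQR_localization_or_inverse:
  assumes ic: "integrally_closed TYPE('a::idom)" and sQQR: "sQQR_domain TYPE('a)"
    and P: "prime_ideal (P::'a set)"
  shows "u \<in> localization P \<or> inverse u \<in> localization P"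
proof -
  have "intersection_of_localizations (adjoin {u\<^sup>2})"
    using sQQR unfolding sQQR_domain_def simple_overring_def by blast
  then obtain \<P> where \<P>: "\<And>Q. Q \<in> \<P> \<Longrightarrow> prime_ideal Q"
    and eq: "adjoin {u\<^sup>2} = (\<Inter>Q\<in>\<P>. localization Q)"
    unfolding intersection_of_localizations_def by blast
  have "u\<^sup>2 \<in> adjoin {u\<^sup>2}"
    using subset_adjoin by blast
  then have "u \<in> adjoin {u\<^sup>2}"
    unfolding eq using localization_sqrt[OF ic] \<P> by blast
  then obtain p where p: "u = poly (fract_poly p) (u\<^sup>2)"
    by (rule adjoin_singletonE)
  \<comment> \<open>\<open>p(X^2)\<close> has no odd powers, so \<open>p(X^2) - X\<close> has linear
    coefficient \<open>- 1\<close>, a unit and thus outside \<open>P\<close>.\<close>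
  define q where "q = pcompose p [:0, 0, 1:] - [:0, 1:]"
  have "poly (fract_poly q) u = 0"
    using p by (simp add: q_def poly_fract_poly_pcompose map_poly_pCons power2_eq_square)
  moreover have "coeff (pcompose p [:0, 0, 1:]) 1 = 0"
    by (cases p) (simp add: pcompose_pCons coeff_pCons)
  then have "coeff q 1 = - 1"
    by (simp add: q_def)
  then have "coeff q 1 \<notin> P"
    using prime_idealD(2)[OF P] prime_idealD(4)[OF P, of "- 1" "- 1"] by auto
  ultimately show ?thesis
    by (rule localization_or_inverse[OF ic P])
qed

subsection \<open>Invertible ideals\<close>

text \<open>The second hypothesis makes divisibility in \<open>R_P\<close> a total preorder, so a
  finite set has an element dividing all others.\<close>

lemma finite_localization_generator:
  assumes P: "prime_ideal P" and "\<And>u. u \<in> localization P \<or> inverse u \<in> localization P"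
    and "finite A" "A \<noteq> {}" "0 \<notin> A"
  shows "\<exists>a\<in>A. \<forall>b\<in>A. to_fract b / to_fract a \<in> localization P"
  using assms(3-5)
proof (induction A rule: finite_ne_induct)
  case (singleton x)
  then show ?case
    using localization_closed(1)[OF P, of 1] by simp
next
  case (insert x F)
  then obtain a where a: "a \<in> F" "\<And>b. b \<in> F \<Longrightarrow> to_fract b / to_fract a \<in> localization P"
    by blast
  have nz: "to_fract a \<noteq> 0" "to_fract x \<noteq> 0"
    using insert.prems a(1) by auto
  show ?case
  proof (cases "to_fract x / to_fract a \<in> localization P")
    case True
    with a show ?thesis by blast
  next
    case False
    then have ax: "to_fract a / to_fract x \<in> localization P"
      using assms(2)[of "to_fract x / to_fract a"] by simp
    \<comment> \<open>\<open>x\<close> replaces \<open>a\<close>, because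
      \<open>b / x = (b / a) (a / x)\<close>.\<close>
    have "to_fract b / to_fract x \<in> localization P" if "b \<in> F" for b
      using localization_closed(2)[OF P a(2)[OF that] ax] nz by simp
    moreover have "to_fract x / to_fract x \<in> localization P"
      using localization_closed(1)[OF P, of 1] nz by simp
    ultimately show ?thesis by blast
  qed
qed

lemma localization_common_denominator:
  assumes P: "prime_ideal P" and "finite B" "B \<subseteq> localization P"
  shows "\<exists>s. s \<notin> P \<and> (\<forall>x\<in>B. to_fract s * x \<in> range to_fract)"
  using assms(2,3)
proof (induction B rule: finite_induct)
  case empty
  then show ?case
    using prime_idealD(2)[OF P] by blast
next
  case (insert y F)
  then obtain s where s: "s \<notin> P" "\<And>x. x \<in> F \<Longrightarrow> to_fract s * x \<in> range to_fract"
    by blast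
  obtain t a where t: "t \<notin> P" "to_fract t * y = to_fract a"
    using insert.prems by (auto simp: localization_iff[OF P])
  have "to_fract (s * t) * x \<in> range to_fract" if x: "x \<in> insert y F" for x
  proof (cases "x = y")
    case True
    then have "to_fract (s * t) * x = to_fract s * (to_fract t * y)"
      by (simp add: mult_ac)
    then have "to_fract (s * t) * x = to_fract (s * a)"
      by (simp only: t(2) to_fract_mult)
    then show ?thesis by (rule range_eqI)
  next
    case False
    with x have "x \<in> F"
      by simp
    then obtain b where b: "to_fract s * x = to_fract b"
      using s(2) by blast
    have "to_fract (s * t) * x = to_fract t * (to_fract s * x)"
      by (simp add: mult_ac)
    then have "to_fract (s * t) * x = to_fract (t * b)"
      by (simp only: b to_fract_mult)
    then show ?thesis by (rule range_eqI)
  qed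
  moreover have "s * t \<notin> P"
    using s(1) t(1) prime_idealD(5)[OF P] by blast
  ultimately show ?case by blast
qed

text \<open>Lets a membership checked on generators of an ideal pass to their span.\<close>

lemma subspace_colon:
  assumes "submodule.subspace N"
  shows "ideal.subspace {c. to_fract c * x \<in> N}"
  using assms by (auto simp: ideal.subspace_def submodule.subspace_def distrib_right mult.assoc)

lemma subspace_colon_ideal:
  assumes "submodule.subspace N"
  shows "submodule.subspace {x. \<forall>a\<in>I. to_fract a * x \<in> N}"
  using assms by (simp add: submodule.subspace_def distrib_left mult.left_commute)

lemma subspace_to_fract_image:
  assumes "ideal.subspace I"
  shows "submodule.subspace (to_fract ` I)"
  using assms by (auto simp: ideal.subspace_def submodule.subspace_def
                    simp flip: to_fract_add to_fract_mult to_fract_0)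

lemma subspace_range_to_fract: "submodule.subspace (range to_fract)"
  by (rule subspace_to_fract_image) simp

lemma invertible_ideal_localizationI:
  assumes "finite (A::'a::idom set)" and "ideal.span A \<noteq> {0}"
    and val: "\<And>(P::'a set) u. prime_ideal P \<Longrightarrow> u \<in> localization P \<or> inverse u \<in> localization P"
  shows "invertible_ideal (ideal.span A)"
proof -
  define I where "I = ideal.span A"
  \<comment> \<open>\<open>J\<close> is \<open>(R : I)\<close>, the candidate inverse, and
    \<open>S\<close> is the product \<open>I J\<close>. Any nonzero \<open>d\<close> in
    \<open>I\<close> is a common denominator for \<open>J\<close>.\<close>
  define J where "J = {x. \<forall>a\<in>I. to_fract a * x \<in> range to_fract}"
  define S where "S = submodule.span {to_fract a * x | a x. a \<in> I \<and> x \<in> J}"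
  have J: "fractional_ideal J"
  proof -
    have "0 \<in> I"
      unfolding I_def by (rule ideal.span_zero)
    with assms(2) obtain d where "d \<in> I" "d \<noteq> 0"
      unfolding I_def by blast
    moreover have "submodule.subspace J"
      unfolding J_def by (intro subspace_colon_ideal subspace_range_to_fract)
    ultimately show ?thesis
      by (auto simp: fractional_ideal_def J_def)
  qed
  have "1 \<in> S"
  proof (rule ccontr)
    assume "1 \<notin> S"
    have "submodule.subspace S"
      unfolding S_def by (rule submodule.subspace_span)
    then have "ideal.subspace (to_fract -` S)"
      using subspace_colon[of S 1] by (simp add: vimage_def)
    with \<open>1 \<notin> S\<close> obtain P where P: "prime_ideal P" and SP: "to_fract -` S \<subseteq> P"
      using exists_prime_ideal[of "to_fract -` S"] by auto
    have "A - {0} \<noteq> {}"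
    proof
      assume "A - {0} = {}"
      then have "ideal.span A \<subseteq> {0}"
        by (intro ideal.span_minimal) auto
      with assms(2) show False
        using ideal.span_zero[of A] by blast
    qed
    then obtain a where a: "a \<in> A - {0}"
      and gen: "\<And>b. b \<in> A - {0} \<Longrightarrow> to_fract b / to_fract a \<in> localization P"
      using finite_localization_generator[OF P val[OF P], of "A - {0}"] assms(1) by auto
    let ?B = "(\<lambda>b. to_fract b / to_fract a) ` (A - {0})"
    have "finite ?B" "?B \<subseteq> localization P"
      using assms(1) gen by auto
    then obtain s where s: "s \<notin> P" and den: "\<forall>y\<in>?B. to_fract s * y \<in> range to_fract"
      using localization_common_denominator[OF P] by blast
    \<comment> \<open>As \<open>s\<close> clears every \<open>b / a\<close>, this \<open>x\<close>
      lies in \<open>(R : I)\<close>. Then \<open>a x = s\<close> is in \<open>S\<close> but outside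
      \<open>P\<close>, a contradiction.\<close>
    define x where "x = to_fract s / to_fract a"
    have "to_fract b * x \<in> range to_fract" if "b \<in> A" for b
    proof (cases "b = 0")
      case True
      then show ?thesis
        by (auto intro: range_eqI[of _ _ 0])
    next
      case False
      with den that have "to_fract s * (to_fract b / to_fract a) \<in> range to_fract"
        by blast
      then show ?thesis
        by (simp add: x_def mult.commute)
    qed
    then have "I \<subseteq> {c. to_fract c * x \<in> range to_fract}"
      unfolding I_def by (intro ideal.span_minimal subspace_colon subspace_range_to_fract) auto
    then have "x \<in> J"
      unfolding J_def by blast
    moreover have "a \<in> I"
      using a ideal.span_base unfolding I_def by blast
    ultimately have "to_fract a * x \<in> S"
      unfolding S_def by (intro submodule.span_base) blast
    moreover have "to_fract a * x = to_fract s"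
      using a by (simp add: x_def)
    ultimately have "s \<in> P"
      using SP by auto
    with s show False ..
  qed
  then have "to_fract r \<in> S" for r
    using submodule.span_scale[of 1 _ r] unfolding S_def by simp
  moreover have "S \<subseteq> range to_fract"
    unfolding S_def by (intro submodule.span_minimal subspace_range_to_fract) (auto simp: J_def)
  ultimately have "S = range to_fract"
    by blast
  with J show ?thesis
    unfolding invertible_ideal_def S_def I_def by blast
qed

text \<open>If all products of generators with elements of the inverse \<open>J\<close> lay in
  \<open>P\<close>, so would their span, which is \<open>R\<close> and contains
  \<open>1\<close>.\<close>

lemma invertible_ideal_prime_witness:
  assumes "invertible_ideal (ideal.span A)" and P: "prime_ideal P"
  obtains c x where "c \<in> A" "\<forall>a\<in>A. to_fract a * x \<in> range to_fract"
    "to_fract c * x \<notin> to_fract ` P"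
proof -
  obtain J where J:
    "submodule.span {to_fract a * x | a x. a \<in> ideal.span A \<and> x \<in> J} = range to_fract"
    (is "submodule.span ?G = _")
    using assms(1) unfolding invertible_ideal_def by blast
  have PK: "submodule.subspace (to_fract ` P)"
    using P by (intro subspace_to_fract_image) (simp add: prime_ideal_def)
  have "\<exists>c\<in>A. \<exists>x\<in>J. to_fract c * x \<notin> to_fract ` P"
  proof (rule ccontr)
    assume contra: "\<not> ?thesis"
    have "ideal.span A \<subseteq> {c. to_fract c * x \<in> to_fract ` P}" if "x \<in> J" for x
      using that contra by (intro ideal.span_minimal subspace_colon PK) auto
    then have "?G \<subseteq> to_fract ` P"
      by blast
    then have "submodule.span ?G \<subseteq> to_fract ` P"
      using PK by (rule submodule.span_minimal)
    then have "to_fract 1 \<in> to_fract ` P"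
      unfolding J by blast
    with prime_idealD(2)[OF P] show False
      by (auto simp del: to_fract_1)
  qed
  then obtain c x where cx: "c \<in> A" "x \<in> J" "to_fract c * x \<notin> to_fract ` P"
    by blast
  have "to_fract a * x \<in> range to_fract" if "a \<in> A" for a
  proof -
    have "to_fract a * x \<in> submodule.span ?G"
      using ideal.span_base[OF that] cx(2) by (intro submodule.span_base) blast
    then show ?thesis
      by (simp only: J)
  qed
  with cx that show ?thesis by blast
qed

subsection \<open>Overrings of Pruefer domains\<close>

lemma prufer_overring_subset_localization:
  assumes "prufer_domain TYPE('a::idom)"
    and M: "overring_ideal (T::'a fract set) M" and P: "prime_ideal (to_fract -` M)"
  shows "T \<subseteq> localization (to_fract -` M)"
proof
  fix t assume t: "t \<in> T"
  obtain a b where ab: "b \<noteq> 0" "t = to_fract a / to_fract b"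
    by (cases t) (auto simp: Fract_conv_to_fract)
  have "b \<in> ideal.span {a, b}"
    by (rule ideal.span_base) simp
  with ab(1) have "invertible_ideal (ideal.span {a, b})"
    using assms(1)[unfolded prufer_domain_def, rule_format, of "{a, b}"] by auto
  from this P obtain c x where c: "c \<in> {a, b}"
    and R: "\<forall>d\<in>{a, b}. to_fract d * x \<in> range to_fract"
    and cx: "to_fract c * x \<notin> to_fract ` to_fract -` M"
    by (rule invertible_ideal_prime_witness)
  obtain \<alpha> \<beta> where \<alpha>: "to_fract a * x = to_fract \<alpha>" and \<beta>: "to_fract b * x = to_fract \<beta>"
    using R by auto
  \<comment> \<open>The witness \<open>x\<close> rewrites \<open>t = a / b\<close> as
    \<open>\<alpha> / \<beta>\<close> with \<open>\<alpha>\<close> or \<open>\<beta>\<close> outside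
    \<open>P\<close>. If \<open>\<beta>\<close> were in \<open>M\<close>, then
    \<open>\<alpha> = t \<beta>\<close> would be too.\<close>
  have eq: "to_fract \<beta> * t = to_fract \<alpha>"
    unfolding \<alpha>[symmetric] \<beta>[symmetric] using ab by simp
  have "\<beta> \<notin> to_fract -` M"
  proof
    assume "\<beta> \<in> to_fract -` M"
    then have "t * to_fract \<beta> \<in> M"
      using M t by (auto simp: overring_ideal_def)
    then have "\<alpha> \<in> to_fract -` M"
      using eq by (simp add: mult.commute)
    with \<open>\<beta> \<in> to_fract -` M\<close> c have "to_fract c * x \<in> to_fract ` to_fract -` M"
      by (metis \<alpha> \<beta> imageI insertE singletonD)
    with cx show False ..
  qed
  with eq show "t \<in> localization (to_fract -` M)"
    using localization_iff[OF P] by blast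
qed

lemma prufer_imp_intersection_of_localizations:
  assumes prufer: "prufer_domain TYPE('a::idom)" and T: "overring (T::'a fract set)"
  shows "intersection_of_localizations T"
proof -
  \<comment> \<open>With all primes \<open>P\<close> such that \<open>T\<close> lies in
    \<open>R_P\<close>, one inclusion is immediate.\<close>
  let ?\<P> = "{P. prime_ideal P \<and> T \<subseteq> localization P}"
  have R: "to_fract r \<in> T" for r
    using T by (auto simp: overring_def)
  have "z \<in> T" if z: "z \<in> (\<Inter>P\<in>?\<P>. localization P)" for z
  proof (rule ccontr)
    assume "z \<notin> T"
    \<comment> \<open>The ideal of denominators of \<open>z\<close> in \<open>T\<close>, proper
      because \<open>z\<close> is not in \<open>T\<close>. A denominator \<open>s\<close> of
      \<open>z\<close> outside \<open>M\<close> would belong to it, hence to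
      \<open>M\<close>.\<close>
    let ?I = "{t \<in> T. t * z \<in> T}"
    have "x + y \<in> T" "x * y \<in> T" if "x \<in> T" "y \<in> T" for x y
      using T that by (auto simp: overring_def)
    moreover have "0 \<in> T"
      using R[of 0] by simp
    ultimately have "overring_ideal T ?I"
      unfolding overring_ideal_def
      by (intro conjI ballI subsetI) (simp_all add: distrib_right mult.assoc)
    moreover have "1 \<notin> ?I"
      using \<open>z \<notin> T\<close> by simp
    ultimately obtain M where M: "overring_ideal T M" "?I \<subseteq> M" and P: "prime_ideal (to_fract -` M)"
      by (rule exists_prime_contraction[OF T])
    have "z \<in> localization (to_fract -` M)"
      using z P prufer_overring_subset_localization[OF prufer M(1) P] by blast
    then obtain a s where s: "s \<notin> to_fract -` M" "to_fract s * z = to_fract a"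
      by (auto simp: localization_iff[OF P])
    then have "to_fract s \<in> ?I"
      using R by simp
    with M(2) s(1) show False
      by blast
  qed
  then have "T = (\<Inter>P\<in>?\<P>. localization P)"
    by blast
  then show ?thesis
    unfolding intersection_of_localizations_def by (intro exI[of _ ?\<P>] conjI ballI) auto
qed

theorem proposition2p1:
  assumes "integrally_closed TYPE('a::idom)"
  shows "(sQQR_domain TYPE('a) \<longleftrightarrow> fQQR_domain TYPE('a)) \<and>
         (fQQR_domain TYPE('a) \<longleftrightarrow> QQR_domain TYPE('a)) \<and>
         (QQR_domain TYPE('a) \<longleftrightarrow> prufer_domain TYPE('a))"
proof -
  \<comment> \<open>The implications form a circle: QQR, fQQR, sQQR, Pruefer, QQR. Integral
    closedness enters in the step from sQQR to Pruefer.\<close>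
  have "QQR_domain TYPE('a) \<Longrightarrow> fQQR_domain TYPE('a)"
    unfolding QQR_domain_def fQQR_domain_def finitely_generated_overring_def
    using overring_adjoin by blast
  moreover have "finitely_generated_overring T" if "simple_overring T" for T :: "'a fract set"
    using that unfolding simple_overring_def finitely_generated_overring_def
    by (elim exE, intro exI conjI) auto
  then have "fQQR_domain TYPE('a) \<Longrightarrow> sQQR_domain TYPE('a)"
    unfolding fQQR_domain_def sQQR_domain_def by blast
  moreover have "prufer_domain TYPE('a)" if "sQQR_domain TYPE('a)"
    unfolding prufer_domain_def
    using invertible_ideal_localizationI sQQR_localization_or_inverse[OF assms that] by auto
  moreover have "prufer_domain TYPE('a) \<Longrightarrow> QQR_domain TYPE('a)"
    unfolding QQR_domain_def using prufer_imp_intersection_of_localizations by blast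
  ultimately show ?thesis by blast
qed

end
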